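(* Let $f:\mathbb{R}^m\to\mathbb{R}$ be a $C^1$ function and let $\{z_n\}_{n\ge0}$ be a sequence constructed from the Inexact Backtracking GD procedure (with fixed parameters $A_1,A_2,\delta_0>0$, $0<\mu\le1$, $0<\alpha,\beta<1$). Then: 1) Either $\lim_{n\to\infty}\|z_n\|=\infty$ or $\lim_{n\to\infty}\|z_{n+1}-z_n\|=0$. 2) Assume that $f$ has at most countably many critical points. Then either $\lim_{n\to\infty}\|z_n\|=\infty$ or $\{z_n\}$ converges to a critical point of $f$. 3) More generally, assume that all connected components of the set of critical points of $f$ are compact. Then either $\lim_{n\to\infty}\|z_n\|=\infty$ or $\{z_n\}$ is bounded. Moreover, in the latter case the set of cluster points of $\{z_n\}$ is connected.
   Context: $\langle\cdot,\cdot\rangle$ and $\|\cdot\|$ are the standard inner product and Euclidean norm on $\mathbb{R}^m$. A critical point of $f$ is a point where $\nabla f$ vanishes. A cluster point of a sequence is a limit of one of its convergent subsequences (in $\mathbb{R}^m$). Inexact Backtracking GD: fix $A_1,A_2,\delta_0>0$, $1\ge\mu>0$ and $1>\alpha,\beta>0$. Start with a point $z_0\in\mathbb{R}^m$. At each step $n=0,1,2,\ldots$: i) Choose a vector $v_n\in\mathbb{R}^m$ satisfying $A_1\|\nabla f(z_n)\|\le\|v_n\|\le A_2\|\nabla f(z_n)\|$ and $\langle\nabla f(z_n),v_n\rangle\ge\mu\|\nabla f(z_n)\|\,\|v_n\|$. ii) Let $\sigma_n$ be the largest number $\sigma$ among $\{\delta_0,\delta_0\beta,\delta_0\beta^2,\ldots\}$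 such that $f(z_n-\sigma v_n)-f(z_n)\le-\alpha\sigma\langle\nabla f(z_n),v_n\rangle$. iii) Define $z_{n+1}=z_n-\sigma_nv_n$. *)

theory Defs
  imports "HOL-Analysis.Analysis"
begin

text \<open>A total function; the description is meaningful only at points of differentiability.\<close>

definition grad :: "('a::euclidean_space \<Rightarrow> real) \<Rightarrow> 'a \<Rightarrow> 'a" where
  "grad f x = (THE D. GDERIV f x :> D)"

lemma gderiv_grad:
  assumes "f differentiable (at x)"
  shows "GDERIV f x :> grad f x"
proof -
  obtain f' where f': "(f has_derivative f') (at x)"
    using assms by (auto simp: differentiable_def)
  then have lin: "linear f'"
    by (simp add: has_derivative_linear)
  define D where "D = adjoint f' 1"
  have "f' = (\<lambda>h. inner h D)"
    using adjoint_works[OF lin, of _ 1] by (auto simp: D_def)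
  then have D: "GDERIV f x :> D"
    using f' by (simp add: gderiv_def)
  have "E = D" if "GDERIV f x :> E" for E
  proof -
    have "(\<lambda>h. inner h E) = (\<lambda>h. inner h D)"
      using has_derivative_unique that D unfolding gderiv_def by blast
    then show ?thesis
      by (metis vector_eq_ldot)
  qed
  then show ?thesis
    unfolding grad_def using D by (rule theI[of "\<lambda>E. GDERIV f x :> E", rotated])
qed

definition C1_fun :: "('a::euclidean_space \<Rightarrow> real) \<Rightarrow> bool" where
  "C1_fun f \<longleftrightarrow> (\<forall>x. f differentiable (at x)) \<and> continuous_on UNIV (grad f)"

definition critical_points :: "('a::euclidean_space \<Rightarrow> real) \<Rightarrow> 'a set" where
  "critical_points f = {x. grad f x = 0}"

definition cluster_points :: "(nat \<Rightarrow> 'a::topological_space) \<Rightarrow> 'a set" where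
  "cluster_points z = {l. \<exists>r. strict_mono r \<and> (z \<circ> r) \<longlonglongrightarrow> l}"

definition admissible_steps ::
    "real \<Rightarrow> real \<Rightarrow> real \<Rightarrow> ('a::euclidean_space \<Rightarrow> real) \<Rightarrow> 'a \<Rightarrow> 'a \<Rightarrow> real set" where
  "admissible_steps \<delta>\<^sub>0 \<alpha> \<beta> f x v =
     {\<sigma>. (\<exists>k::nat. \<sigma> = \<delta>\<^sub>0 * \<beta> ^ k) \<and>
         f (x - \<sigma> *\<^sub>R v) - f x \<le> - \<alpha> * \<sigma> * inner (grad f x) v}"

definition inexact_backtracking_GD ::
    "real \<Rightarrow> real \<Rightarrow> real \<Rightarrow> real \<Rightarrow> real \<Rightarrow> real \<Rightarrow>
     ('a::euclidean_space \<Rightarrow> real) \<Rightarrow> (nat \<Rightarrow> 'a) \<Rightarrow> bool" where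
  "inexact_backtracking_GD A\<^sub>1 A\<^sub>2 \<delta>\<^sub>0 \<mu> \<alpha> \<beta> f z \<longleftrightarrow>
     (\<exists>(v :: nat \<Rightarrow> 'a) (\<sigma> :: nat \<Rightarrow> real). \<forall>n.
        A\<^sub>1 * norm (grad f (z n)) \<le> norm (v n) \<and>
        norm (v n) \<le> A\<^sub>2 * norm (grad f (z n)) \<and>
        inner (grad f (z n)) (v n) \<ge> \<mu> * norm (grad f (z n)) * norm (v n) \<and>
        \<sigma> n \<in> admissible_steps \<delta>\<^sub>0 \<alpha> \<beta> f (z n) (v n) \<and>
        (\<forall>\<tau> \<in> admissible_steps \<delta>\<^sub>0 \<alpha> \<beta> f (z n) (v n). \<tau> \<le> \<sigma> n) \<and>
        z (Suc n) = z n - \<sigma> n *\<^sub>R v n)"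

end

theory Submission
  imports Defs
begin

text \<open>
  The sufficient decrease condition, with the angle and length conditions on \<open>v\<^sub>n\<close>, gives
  \<open>f(z\<^sub>n\<^sub>+\<^sub>1) + c \<parallel>z\<^sub>n\<^sub>+\<^sub>1 - z\<^sub>n\<parallel>\<^sup>2 \<le> f(z\<^sub>n)\<close> with \<open>c = \<alpha>\<mu>/(A\<^sub>2\<delta>\<^sub>0)\<close>. If a cluster point exists then
  \<open>f(z\<^sub>n)\<close> converges, so the steps tend to 0. Near a noncritical point the
  steps are bounded below, so cluster points are critical. Finally, a sequence whose steps tend to 0
  cannot cross infinitely often a compact annulus that is free of cluster points; hence a nonempty compact
  relatively clopen set of cluster points attracts the whole sequence. By Sura-Bura
  such sets exist around every compact component of the cluster set.
\<close>

section \<open>Cluster points of sequences\<close>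

lemma frequently_compact_imp_cluster_point:
  fixes z :: "nat \<Rightarrow> 'a::metric_space"
  assumes "compact K" and "\<exists>\<^sub>F n in sequentially. z n \<in> K"
  obtains l where "l \<in> K" "l \<in> cluster_points z"
proof -
  have "infinite {n. z n \<in> K}"
    using assms(2) by (simp add: cofinite_eq_sequentially [symmetric] frequently_cofinite)
  then obtain r :: "nat \<Rightarrow> nat" where r: "strict_mono r" "\<And>n. z (r n) \<in> K"
    using infinite_enumerate by blast
  then obtain l s where l: "l \<in> K" "strict_mono s" "((z \<circ> r) \<circ> s) \<longlonglongrightarrow> l"
    using assms(1) unfolding compact_def by (metis comp_apply)
  then have "l \<in> cluster_points z"
    unfolding cluster_points_def using strict_mono_o [OF r(1) l(2)] by (auto simp: o_assoc)
  with l that show thesis by blast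
qed

text \<open>Closed balls are compact, so one that is visited infinitely often would contain a
  cluster point.\<close>

lemma no_cluster_points_imp_norm_at_top:
  fixes z :: "nat \<Rightarrow> 'a::euclidean_space"
  assumes "cluster_points z = {}"
  shows "filterlim (\<lambda>n. norm (z n)) at_top sequentially"
  unfolding filterlim_at_top
proof
  fix B :: real
  have "\<not> (\<exists>\<^sub>F n in sequentially. z n \<in> cball 0 B)"
    using frequently_compact_imp_cluster_point [OF compact_cball] assms by blast
  then show "\<forall>\<^sub>F n in sequentially. B \<le> norm (z n)"
    unfolding not_frequently by (rule eventually_mono) auto
qed

lemma frequently_near_cluster_point:
  assumes "l \<in> cluster_points z" "open U" "l \<in> U"
  shows "\<exists>\<^sub>F n in sequentially. z n \<in> U"
proof -
  obtain r :: "nat \<Rightarrow> nat" where r: "strict_mono r" "(z \<circ> r) \<longlonglongrightarrow> l"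
    using assms(1) unfolding cluster_points_def by blast
  have "\<forall>\<^sub>F n in sequentially. (z \<circ> r) n \<in> U"
    using r(2) assms(2,3) by (rule topological_tendstoD)
  then obtain M where M: "\<And>n. M \<le> n \<Longrightarrow> z (r n) \<in> U"
    unfolding eventually_sequentially by auto
  show ?thesis
    unfolding frequently_sequentially
  proof
    fix N
    have "N \<le> r (max M N)"
      using seq_suble [OF r(1), of "max M N"] by linarith
    then show "\<exists>n\<ge>N. z n \<in> U"
      using M by (metis max.cobounded1)
  qed
qed

text \<open>Writing the cluster set as an intersection of closures of tails makes it visibly closed,
  and contained in the closure of the whole range.\<close>

lemma cluster_points_eq_Inter_closure:
  fixes z :: "nat \<Rightarrow> 'a::metric_space"
  shows "cluster_points z = (\<Inter>N. closure (z ` {N..}))"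
proof (intro equalityI subsetI)
  fix l assume l: "l \<in> cluster_points z"
  have "\<exists>y\<in>z ` {N..}. dist y l < e" if "e > 0" for N e
  proof -
    have "\<exists>\<^sub>F n in sequentially. z n \<in> ball l e"
      using frequently_near_cluster_point [OF l open_ball centre_in_ball [THEN iffD2]] that by blast
    then obtain n where "n \<ge> N" "z n \<in> ball l e"
      unfolding frequently_sequentially by blast
    then show ?thesis
      by (auto simp: dist_commute)
  qed
  then show "l \<in> (\<Inter>N. closure (z ` {N..}))"
    by (auto simp: closure_approachable)
next
  fix l assume l: "l \<in> (\<Inter>N. closure (z ` {N..}))"
  have near: "\<exists>n\<ge>N. dist (z n) l < e" if "e > 0" for N e
  proof -
    have "l \<in> closure (z ` {N..})"
      using l by (rule INT_D) simp
    with that obtain y where "y \<in> z ` {N..}" "dist y l < e"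
      unfolding closure_approachable by blast
    then show ?thesis by auto
  qed
  \<comment> \<open>Indices are picked one after the other: each lies beyond the previous one, while
    the radius around \<open>l\<close> shrinks to 0.\<close>
  have "\<exists>r. \<forall>n. dist (z (r n)) l < inverse (real (Suc n)) \<and> r n < r (Suc n)"
  proof (rule dependent_nat_choice)
    show "\<exists>x. dist (z x) l < inverse (real (Suc 0))"
      using near [of 1 0] by simp
    show "\<exists>y. dist (z y) l < inverse (real (Suc (Suc n))) \<and> x < y" for x n
      using near [of "inverse (real (Suc (Suc n)))" "Suc x"] unfolding Suc_le_eq
      by (metis inverse_positive_iff_positive of_nat_0_less_iff zero_less_Suc)
  qed
  then obtain r where r: "\<And>n. dist (z (r n)) l < inverse (real (Suc n))" "\<And>n. r n < r (Suc n)"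
    by blast
  have "(\<lambda>n. dist (z (r n)) l) \<longlonglongrightarrow> 0"
    by (rule tendsto_sandwich [OF _ _ tendsto_const LIMSEQ_inverse_real_of_nat])
       (auto intro!: always_eventually less_imp_le r(1) simp del: of_nat_Suc)
  then have "(z \<circ> r) \<longlonglongrightarrow> l"
    by (subst tendsto_dist_iff) (simp add: o_def)
  then show "l \<in> cluster_points z"
    using r(2) by (auto simp: cluster_points_def strict_mono_Suc_iff)
qed

lemma closed_cluster_points:
  fixes z :: "nat \<Rightarrow> 'a::metric_space"
  shows "closed (cluster_points z)"
  by (simp add: cluster_points_eq_Inter_closure closed_INT)

section \<open>Sequences with vanishing steps: attraction by isolated pieces of the cluster
  set\<close>

lemma isolated_cluster_points_attract:
  fixes z :: "nat \<Rightarrow> 'a::euclidean_space"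
  assumes step: "(\<lambda>n. norm (z (Suc n) - z n)) \<longlonglongrightarrow> 0"
    and S: "compact S" "S \<noteq> {}" "S \<subseteq> cluster_points z"
    and T: "closed (cluster_points z - S)"
  shows "(\<lambda>n. infdist (z n) S) \<longlonglongrightarrow> 0"
proof -
  obtain d where "d > 0" and d: "\<And>x y. x \<in> S \<Longrightarrow> y \<in> cluster_points z - S \<Longrightarrow> d \<le> dist x y"
    using separate_compact_closed [OF S(1) T] by blast
  have "\<forall>\<^sub>F n in sequentially. infdist (z n) S < e" if "e > 0" for e
  proof -
    \<comment> \<open>The shell \<open>K\<close> has outer radius \<open>e'\<close>, below
      \<open>d\<close>, so it misses the cluster points outside \<open>S\<close>; its positive inner
      radius \<open>e' / 2\<close> keeps it off \<open>S\<close> itself.\<close>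
    define e' where "e' = min e d / 2"
    have e': "e' > 0" "e' < e" "e' < d"
      using \<open>e > 0\<close> \<open>d > 0\<close> by (auto simp: e'_def min_def)
    define K where "K = {p. infdist p S \<le> e'} \<inter> {p. e' / 2 \<le> infdist p S}"
    have "compact K"
      unfolding K_def
      by (intro compact_Int_closed compact_infdist_le closed_Collect_le continuous_intros)
         (use S e' in auto)
    have disj: "K \<inter> cluster_points z = {}"
    proof (rule ccontr)
      assume "K \<inter> cluster_points z \<noteq> {}"
      then obtain p where p: "p \<in> K" "p \<in> cluster_points z" by blast
      obtain s where s: "s \<in> S" "infdist p S = dist p s"
        using infdist_attains_inf [OF compact_imp_closed [OF S(1)] S(2)] by blast
      have "p \<notin> S"
        using p(1) e'(1) by (auto simp: K_def)
      then have "d \<le> dist p s"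
        using d [OF s(1)] p(2) by (simp add: dist_commute)
      with s p(1) e' show False
        by (simp add: K_def)
    qed
    have "\<forall>\<^sub>F n in sequentially. z n \<notin> K"
      using frequently_compact_imp_cluster_point [OF \<open>compact K\<close>, of z] disj
      unfolding frequently_def by blast
    moreover have "\<forall>\<^sub>F n in sequentially. norm (z (Suc n) - z n) < e' / 2"
      using order_tendstoD(2) [OF step, of "e' / 2"] e'(1) by simp
    ultimately have "\<forall>\<^sub>F n in sequentially. z n \<notin> K \<and> norm (z (Suc n) - z n) < e' / 2"
      by (rule eventually_conj)
    then obtain N where N: "\<And>n. N \<le> n \<Longrightarrow> z n \<notin> K \<and> norm (z (Suc n) - z n) < e' / 2"
      unfolding eventually_sequentially by auto
    obtain l where l: "l \<in> S" using S(2) by blast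
    have "\<exists>\<^sub>F n in sequentially. z n \<in> ball l (e' / 2)"
      using frequently_near_cluster_point [OF _ open_ball centre_in_ball [THEN iffD2]] l S(3) e'(1)
      by (metis half_gt_zero subsetD)
    then obtain M where M: "M \<ge> N" "dist l (z M) < e' / 2"
      unfolding frequently_sequentially by auto
    \<comment> \<open>From inside the inner radius, a step shorter than the width
      \<open>e' / 2\<close> of the shell ends at distance less than \<open>e'\<close>. Since the
      shell is no longer visited, the new point is again inside the inner radius.\<close>
    have "infdist (z n) S < e' / 2" if "n \<ge> M" for n
      using that
    proof (induction n rule: dec_induct)
      case base
      show ?case
        using infdist_le [OF l, of "z M"] M(2) by (simp add: dist_commute)
    next
      case (step n)
      have "n \<ge> N" using step M by simp
      have "infdist (z (Suc n)) S < e'"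
        using infdist_triangle [of "z (Suc n)" S "z n"] step.IH N [OF \<open>n \<ge> N\<close>]
        by (simp add: dist_norm)
      moreover have "z (Suc n) \<notin> K"
        using N [of "Suc n"] \<open>n \<ge> N\<close> by simp
      ultimately show ?case
        by (simp add: K_def)
    qed
    moreover have "e' / 2 < e"
      using e' by simp
    ultimately show ?thesis
      unfolding eventually_sequentially by (meson less_trans)
  qed
  then show ?thesis
    by (simp add: tendsto_iff dist_norm infdist_nonneg)
qed

text \<open>As the distance to \<open>S\<close> tends to 0, a tail stays within distance 1 of a
  compact set, and each subsequential limit has distance 0 from the closed set
  \<open>S\<close>.\<close>

lemma isolated_cluster_points_imp:
  fixes z :: "nat \<Rightarrow> 'a::euclidean_space"
  assumes step: "(\<lambda>n. norm (z (Suc n) - z n)) \<longlonglongrightarrow> 0"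
    and S: "compact S" "S \<noteq> {}" "S \<subseteq> cluster_points z"
    and T: "closed (cluster_points z - S)"
  shows "bounded (range z)" and "cluster_points z = S"
proof -
  note lim = isolated_cluster_points_attract [OF assms]
  have "\<forall>\<^sub>F n in sequentially. infdist (z n) S < 1"
    using order_tendstoD(2) [OF lim] by simp
  then obtain N where N: "\<And>n. N \<le> n \<Longrightarrow> infdist (z n) S < 1"
    unfolding eventually_sequentially by auto
  have "range z \<subseteq> z ` {..<N} \<union> {x. infdist x S \<le> 1}"
  proof (intro subsetI, elim rangeE)
    fix x n assume "x = z n"
    then show "x \<in> z ` {..<N} \<union> {x. infdist x S \<le> 1}"
      using N [of n] by (cases "n < N") auto
  qed
  moreover have "bounded (z ` {..<N} \<union> {x. infdist x S \<le> 1})"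
    using compact_imp_bounded [OF compact_infdist_le [OF S(2,1), of 1]]
    by (simp add: finite_imp_bounded)
  ultimately show "bounded (range z)"
    by (rule bounded_subset [rotated])
  show "cluster_points z = S"
  proof
    show "cluster_points z \<subseteq> S"
    proof
      fix l assume "l \<in> cluster_points z"
      then obtain r :: "nat \<Rightarrow> nat" where r: "strict_mono r" "(z \<circ> r) \<longlonglongrightarrow> l"
        unfolding cluster_points_def by blast
      have "(\<lambda>n. infdist ((z \<circ> r) n) S) \<longlonglongrightarrow> infdist l S"
        by (intro tendsto_infdist r)
      moreover have "(\<lambda>n. infdist ((z \<circ> r) n) S) \<longlonglongrightarrow> 0"
        using LIMSEQ_subseq_LIMSEQ [OF lim r(1)] by (simp add: o_def)
      ultimately have "infdist l S = 0"
        by (rule LIMSEQ_unique)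
      then show "l \<in> S"
        using in_closed_iff_infdist_zero compact_imp_closed S by blast
    qed
  qed (rule S)
qed

text \<open>In a separation of the cluster set into \<open>A\<close> and \<open>B\<close>,
  boundedness makes \<open>A\<close> compact, and its complement \<open>B\<close> is closed. So
  \<open>A\<close> alone would attract the sequence, leaving no cluster points for
  \<open>B\<close>.\<close>

lemma connected_cluster_points:
  fixes z :: "nat \<Rightarrow> 'a::euclidean_space"
  assumes step: "(\<lambda>n. norm (z (Suc n) - z n)) \<longlonglongrightarrow> 0"
    and bdd: "bounded (range z)"
  shows "connected (cluster_points z)"
proof (rule ccontr)
  assume "\<not> connected (cluster_points z)"
  then obtain A B where AB: "closed A" "closed B" "A \<noteq> {}" "B \<noteq> {}"
      "A \<union> B = cluster_points z" "A \<inter> B = {}"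
    unfolding connected_closed_set [OF closed_cluster_points] by auto
  have "cluster_points z \<subseteq> closure (z ` {0..})"
    unfolding cluster_points_eq_Inter_closure by (rule INT_lower) simp
  then have "bounded (cluster_points z)"
    using bounded_subset [OF bounded_closure [OF bdd]] by simp
  then have "compact A"
    using AB bounded_subset [of "cluster_points z" A] compact_eq_bounded_closed by auto
  moreover have "cluster_points z - A = B"
    using AB by blast
  ultimately have "cluster_points z = A"
    using isolated_cluster_points_imp(2) [OF step] AB by blast
  with AB show False by blast
qed

text \<open>A component need not be relatively open, so \<open>C\<close> itself may fail to be
  isolated. Sura-Bura, applied in the closed and hence locally compact cluster set, enlarges it to a
  compact relatively open \<open>K\<close>, which is.\<close>

lemma bounded_if_cluster_component_compact:
  fixes z :: "nat \<Rightarrow> 'a::euclidean_space"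
  assumes step: "(\<lambda>n. norm (z (Suc n) - z n)) \<longlonglongrightarrow> 0"
    and C: "C \<in> components (cluster_points z)" "compact C"
  shows "bounded (range z)"
proof -
  obtain K where K: "openin (top_of_set (cluster_points z)) K" "compact K" "C \<subseteq> K"
    using Sura_Bura_clopen_subset [OF closed_imp_locally_compact [OF closed_cluster_points] C, of UNIV]
    by auto
  have "closed (cluster_points z - K)"
    using K(1) closedin_closed_trans [OF _ closed_cluster_points]
    by (metis closedin_diff closedin_topspace topspace_euclidean_subtopology)
  moreover have "K \<noteq> {}"
    using in_components_nonempty [OF C(1)] K(3) by blast
  ultimately show ?thesis
    using isolated_cluster_points_imp(1) [OF step K(2)] openin_imp_subset [OF K(1)] by blast
qed

section \<open>The line search and the resulting descent\<close>

text \<open>By the mean value theorem the drop of \<open>f\<close> is \<open>s\<close> times the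
  slope at an intermediate point. Cauchy-Schwarz and the angle condition bound the loss of slope by
  the fraction 1 - \<alpha> of the initial slope, so at least the fraction \<alpha> survives. Read
  backwards: a rejected trial step must reach a point where the gradient has changed
  appreciably.\<close>

lemma sufficient_decrease:
  fixes f :: "'a::euclidean_space \<Rightarrow> real"
  assumes diff: "\<And>x. f differentiable (at x)"
    and "\<alpha> < 1" "s > 0"
    and angle: "\<mu> * norm (grad f y) * norm v \<le> inner (grad f y) v"
    and near: "\<And>t. 0 \<le> t \<Longrightarrow> t \<le> s \<Longrightarrow>
      norm (grad f (y - t *\<^sub>R v) - grad f y) \<le> (1 - \<alpha>) * (\<mu> * norm (grad f y))"
  shows "f (y - s *\<^sub>R v) - f y \<le> - \<alpha> * s * inner (grad f y) v"
proof -
  have "((\<lambda>t. f (y - t *\<^sub>R v)) has_derivative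
      (\<lambda>h. inner (- (h *\<^sub>R v)) (grad f (y - t *\<^sub>R v)))) (at t within {0..s})" for t
  proof -
    have "(f has_derivative (\<lambda>h. inner h (grad f (y - t *\<^sub>R v)))) (at (y - t *\<^sub>R v))"
      using gderiv_grad [OF diff] by (simp add: gderiv_def)
    moreover have "((\<lambda>t. y - t *\<^sub>R v) has_derivative (\<lambda>h. - (h *\<^sub>R v))) (at t within {0..s})"
      by (auto intro!: derivative_eq_intros)
    ultimately show ?thesis
      using has_derivative_compose by fastforce
  qed
  then have "\<exists>t\<in>{0<..<s}. f (y - s *\<^sub>R v) - f (y - 0 *\<^sub>R v)
      = inner (- ((s - 0) *\<^sub>R v)) (grad f (y - t *\<^sub>R v))"
    by (intro mvt_simple [OF \<open>s > 0\<close>])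
  then obtain t where t: "0 < t" "t < s"
    and mvt: "f (y - s *\<^sub>R v) - f y = - s * inner (grad f (y - t *\<^sub>R v)) v"
    by (auto simp: inner_commute)
  have "inner (grad f y - grad f (y - t *\<^sub>R v)) v
      \<le> norm (grad f (y - t *\<^sub>R v) - grad f y) * norm v"
    using norm_cauchy_schwarz norm_minus_commute by metis
  also have "\<dots> \<le> (1 - \<alpha>) * (\<mu> * norm (grad f y)) * norm v"
    using near [of t] t by (intro mult_right_mono) auto
  also have "\<dots> \<le> (1 - \<alpha>) * inner (grad f y) v"
    using mult_left_mono [OF angle, of "1 - \<alpha>"] \<open>\<alpha> < 1\<close> by (simp add: mult.assoc)
  finally have "\<alpha> * inner (grad f y) v \<le> inner (grad f (y - t *\<^sub>R v)) v"
    by (simp add: inner_diff_left algebra_simps)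
  then have "s * (\<alpha> * inner (grad f y) v) \<le> s * inner (grad f (y - t *\<^sub>R v)) v"
    using \<open>s > 0\<close> by simp
  then show ?thesis
    unfolding mvt by (simp add: mult_ac)
qed

text \<open>One run of the procedure, with the existentially quantified directions and step sizes of
  \<open>inexact_backtracking_GD\<close> turned into parameters.\<close>

locale backtracking_GD =
  fixes A\<^sub>1 A\<^sub>2 \<delta>\<^sub>0 \<mu> \<alpha> \<beta> :: real
    and f :: "'a::euclidean_space \<Rightarrow> real"
    and z v :: "nat \<Rightarrow> 'a" and \<sigma> :: "nat \<Rightarrow> real"
  assumes A\<^sub>1: "0 < A\<^sub>1" and A\<^sub>2: "0 < A\<^sub>2" and \<delta>\<^sub>0: "0 < \<delta>\<^sub>0"
    and \<mu>: "0 < \<mu>" "\<mu> \<le> 1" and \<alpha>: "0 < \<alpha>" "\<alpha> < 1" and \<beta>: "0 < \<beta>" "\<beta> < 1"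
    and C1: "C1_fun f"
    and v_lower: "A\<^sub>1 * norm (grad f (z n)) \<le> norm (v n)"
    and v_upper: "norm (v n) \<le> A\<^sub>2 * norm (grad f (z n))"
    and angle: "\<mu> * norm (grad f (z n)) * norm (v n) \<le> inner (grad f (z n)) (v n)"
    and \<sigma>_admissible: "\<sigma> n \<in> admissible_steps \<delta>\<^sub>0 \<alpha> \<beta> f (z n) (v n)"
    and \<sigma>_maximal: "\<tau> \<in> admissible_steps \<delta>\<^sub>0 \<alpha> \<beta> f (z n) (v n) \<Longrightarrow> \<tau> \<le> \<sigma> n"
    and z_Suc: "z (Suc n) = z n - \<sigma> n *\<^sub>R v n"
begin

lemma differentiable: "f differentiable (at x)"
  using C1 by (simp add: C1_fun_def)

lemma isCont_grad: "isCont (grad f) x"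
  using C1 by (simp add: C1_fun_def continuous_on_eq_continuous_at)

lemma isCont_f: "isCont f x"
  using differentiable by (rule differentiable_imp_continuous_within)

lemma \<sigma>_bounds: "0 < \<sigma> n" "\<sigma> n \<le> \<delta>\<^sub>0"
proof -
  obtain k where "\<sigma> n = \<delta>\<^sub>0 * \<beta> ^ k"
    using \<sigma>_admissible by (auto simp: admissible_steps_def)
  moreover have "\<beta> ^ k \<le> 1"
    using \<beta> by (simp add: power_le_one)
  ultimately show "0 < \<sigma> n" "\<sigma> n \<le> \<delta>\<^sub>0"
    using \<delta>\<^sub>0 \<beta> by auto
qed

lemma norm_step: "norm (z (Suc n) - z n) = \<sigma> n * norm (v n)"
  using \<sigma>_bounds(1) [of n] by (simp add: z_Suc)

lemma descent:
  "f (z (Suc n)) + \<alpha> * \<mu> / (A\<^sub>2 * \<delta>\<^sub>0) * (norm (z (Suc n) - z n))\<^sup>2 \<le> f (z n)"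
proof -
  note \<sigma> = \<sigma>_bounds [of n]
  have "(norm (z (Suc n) - z n))\<^sup>2 = \<sigma> n * (\<sigma> n * (norm (v n) * norm (v n)))"
    by (simp add: norm_step power2_eq_square mult_ac)
  \<comment> \<open>Only one factor \<open>\<sigma> n\<close> and one factor
    \<open>norm (v n)\<close> are estimated; the remaining ones form the product to which the angle
    condition applies.\<close>
  also have "\<dots> \<le> \<delta>\<^sub>0 * (\<sigma> n * ((A\<^sub>2 * norm (grad f (z n))) * norm (v n)))"
    using \<sigma> v_upper [of n] \<delta>\<^sub>0 A\<^sub>2 by (intro mult_mono mult_nonneg_nonneg order_refl) auto
  finally have "\<alpha> * \<mu> / (A\<^sub>2 * \<delta>\<^sub>0) * (norm (z (Suc n) - z n))\<^sup>2
      \<le> \<alpha> * \<mu> / (A\<^sub>2 * \<delta>\<^sub>0) * (\<delta>\<^sub>0 * (\<sigma> n * ((A\<^sub>2 * norm (grad f (z n))) * norm (v n))))"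
    using \<alpha> \<mu> A\<^sub>2 \<delta>\<^sub>0 by (intro mult_left_mono) auto
  also have "\<dots> = \<alpha> * \<sigma> n * (\<mu> * norm (grad f (z n)) * norm (v n))"
    using A\<^sub>2 \<delta>\<^sub>0 by (simp add: field_simps)
  also have "\<dots> \<le> \<alpha> * \<sigma> n * inner (grad f (z n)) (v n)"
    using angle [of n] \<alpha> \<sigma> by (intro mult_left_mono) auto
  also have "\<dots> \<le> f (z n) - f (z (Suc n))"
    using \<sigma>_admissible [of n] by (simp add: admissible_steps_def z_Suc)
  finally show ?thesis
    by simp
qed

lemma steps_tendsto_0:
  assumes "cluster_points z \<noteq> {}"
  shows "(\<lambda>n. norm (z (Suc n) - z n)) \<longlonglongrightarrow> 0"
proof -
  define c where "c = \<alpha> * \<mu> / (A\<^sub>2 * \<delta>\<^sub>0)"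
  have c: "c > 0"
    using \<alpha> \<mu> A\<^sub>2 \<delta>\<^sub>0 by (simp add: c_def)
  have desc: "c * (norm (z (Suc n) - z n))\<^sup>2 \<le> f (z n) - f (z (Suc n))" for n
    using descent [of n] by (simp add: c_def)
  have dec: "decseq (\<lambda>n. f (z n))"
  proof (rule decseq_SucI)
    fix n
    have "0 \<le> c * (norm (z (Suc n) - z n))\<^sup>2"
      using c by simp
    with desc [of n] show "f (z (Suc n)) \<le> f (z n)"
      by linarith
  qed
  obtain l r where r: "strict_mono r" "(z \<circ> r) \<longlonglongrightarrow> l"
    using assms unfolding cluster_points_def by auto
  have lim: "(\<lambda>n. f (z (r n))) \<longlonglongrightarrow> f l"
    using isCont_tendsto_compose [OF isCont_f r(2)] by (simp add: o_def)
  \<comment> \<open>Along the subsequence the values decrease to \<open>f l\<close>, and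
    \<open>r n\<close> is at least \<open>n\<close>, so \<open>f l\<close> bounds the entire
    decreasing sequence from below.\<close>
  have "f l \<le> f (z n)" for n
  proof -
    have "decseq (\<lambda>n. f (z (r n)))"
      using dec strict_mono_leD [OF r(1)] by (auto simp: decseq_def)
    then have "f l \<le> f (z (r n))"
      using lim by (rule decseq_ge)
    also have "\<dots> \<le> f (z n)"
      using dec seq_suble [OF r(1)] by (simp add: decseq_def)
    finally show ?thesis .
  qed
  then obtain L where L: "(\<lambda>n. f (z n)) \<longlonglongrightarrow> L"
    using decseq_convergent [OF dec] by blast
  have "(\<lambda>n. (f (z n) - f (z (Suc n))) / c) \<longlonglongrightarrow> (L - L) / c"
    using c by (intro tendsto_intros L LIMSEQ_Suc) auto
  then have lim0: "(\<lambda>n. (f (z n) - f (z (Suc n))) / c) \<longlonglongrightarrow> 0"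
    by simp
  \<comment> \<open>The squared step is squeezed between 0 and a multiple of consecutive differences
    of a convergent sequence.\<close>
  have "(norm (z (Suc n) - z n))\<^sup>2 \<le> (f (z n) - f (z (Suc n))) / c" for n
    using c desc [of n] by (simp add: pos_le_divide_eq mult.commute)
  then have "(\<lambda>n. (norm (z (Suc n) - z n))\<^sup>2) \<longlonglongrightarrow> 0"
    by (intro tendsto_sandwich [OF _ _ tendsto_const lim0] always_eventually allI) simp_all
  from tendsto_real_sqrt [OF this] show ?thesis
    by simp
qed

text \<open>Either the first trial \<open>\<delta>\<^sub>0\<close> is accepted, and the step is long
  because the gradient is not small, or the preceding trial was rejected, hence was long, and the
  accepted step is \<beta> times it. The two cases give the two terms in the minimum
  \<open>c\<close>.\<close>

lemma step_lower_bound_near_noncritical: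
  assumes "grad f x \<noteq> 0"
  obtains r c where "0 < r" "0 < c" "\<And>n. z n \<in> ball x r \<Longrightarrow> c \<le> norm (z (Suc n) - z n)"
proof -
  define G where "G = norm (grad f x)"
  \<comment> \<open>Two gradients within \<open>e\<close> of \<open>grad f x\<close> differ by at
    most \<open>2 * e\<close>, which is what \<open>sufficient_decrease\<close> tolerates when the
    gradient norm is at least \<open>G / 2\<close>. That lower bound holds near \<open>x\<close>
    because \<open>e\<close> is at most \<open>G / 4\<close>.\<close>
  define e where "e = (1 - \<alpha>) * \<mu> * G / 4"
  have G: "G > 0" using assms by (simp add: G_def)
  have e: "e > 0" using G \<alpha> \<mu> by (simp add: e_def)
  have "(1 - \<alpha>) * \<mu> * G \<le> 1 * G"
    using \<alpha> \<mu> G by (intro mult_right_mono mult_le_one) auto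
  then have eG: "e \<le> G / 4" by (simp add: e_def)
  obtain d where d: "d > 0" "\<And>y. dist y x < d \<Longrightarrow> norm (grad f y - grad f x) < e"
    using isCont_grad [of x] e unfolding continuous_at_eps_delta by (auto simp: dist_norm)
  define c where "c = min (\<beta> * (d / 2)) (\<delta>\<^sub>0 * (A\<^sub>1 * (G / 2)))"
  have "c \<le> norm (z (Suc n) - z n)" if zn: "z n \<in> ball x (d / 2)" for n
  proof -
    have "norm (grad f (z n) - grad f x) < e"
      using zn d by (simp add: dist_commute)
    then have g: "G / 2 \<le> norm (grad f (z n))"
      using norm_triangle_ineq2 [of "grad f x" "grad f (z n)"] eG G
      unfolding G_def norm_minus_commute [of "grad f x"] by linarith
    obtain k where k: "\<sigma> n = \<delta>\<^sub>0 * \<beta> ^ k"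
      using \<sigma>_admissible by (auto simp: admissible_steps_def)
    show ?thesis
    proof (cases k)
      case 0
      have "\<delta>\<^sub>0 * (A\<^sub>1 * (G / 2)) \<le> \<delta>\<^sub>0 * (A\<^sub>1 * norm (grad f (z n)))"
        using g A\<^sub>1 \<delta>\<^sub>0 by (intro mult_left_mono) auto
      also have "\<dots> \<le> \<delta>\<^sub>0 * norm (v n)"
        using v_lower [of n] \<delta>\<^sub>0 by (intro mult_left_mono) auto
      finally show ?thesis
        using 0 k by (simp add: norm_step c_def)
    next
      case (Suc j)
      \<comment> \<open>The trial just before \<open>\<sigma> n\<close>: it is larger, as \<beta> <
        1, so maximality means that it was rejected.\<close>
      define \<tau> where "\<tau> = \<delta>\<^sub>0 * \<beta> ^ j"
      have \<tau>: "\<tau> > 0" "\<sigma> n = \<beta> * \<tau>"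
        using \<delta>\<^sub>0 \<beta> k Suc by (auto simp: \<tau>_def)
      have "\<tau> \<notin> admissible_steps \<delta>\<^sub>0 \<alpha> \<beta> f (z n) (v n)"
        using \<sigma>_maximal [of \<tau> n] \<tau> \<beta> by auto
      then have fail: "\<not> f (z n - \<tau> *\<^sub>R v n) - f (z n) \<le> - \<alpha> * \<tau> * inner (grad f (z n)) (v n)"
        by (auto simp: admissible_steps_def \<tau>_def)
      \<comment> \<open>Otherwise the whole trial segment, starting within \<open>d / 2\<close> of
        \<open>x\<close>, would stay within \<open>d\<close> of \<open>x\<close>, where the gradient
        is nearly constant, and the trial would have been accepted.\<close>
      have "d / 2 < \<tau> * norm (v n)"
      proof (rule ccontr)
        assume "\<not> d / 2 < \<tau> * norm (v n)"
        then have short: "\<tau> * norm (v n) \<le> d / 2" by simp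
        have "norm (grad f (z n - t *\<^sub>R v n) - grad f (z n))
            \<le> (1 - \<alpha>) * (\<mu> * norm (grad f (z n)))" if t: "0 \<le> t" "t \<le> \<tau>" for t
        proof -
          have "dist (z n - t *\<^sub>R v n) (z n) \<le> d / 2"
            using mult_right_mono [OF t(2), of "norm (v n)"] t(1) short by (simp add: dist_norm)
          then have "dist (z n - t *\<^sub>R v n) x < d"
            using dist_triangle [of "z n - t *\<^sub>R v n" x "z n"] zn by (simp add: dist_commute)
          then have "norm (grad f (z n - t *\<^sub>R v n) - grad f x) < e"
            by (rule d)
          then have "norm (grad f (z n - t *\<^sub>R v n) - grad f (z n)) \<le> 2 * e"
            using \<open>norm (grad f (z n) - grad f x) < e\<close>
              norm_triangle_ineq4 [of "grad f (z n - t *\<^sub>R v n) - grad f x" "grad f (z n) - grad f x"]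
            by simp
          also have "2 * e = (1 - \<alpha>) * (\<mu> * (G / 2))"
            by (simp add: e_def)
          also have "\<dots> \<le> (1 - \<alpha>) * (\<mu> * norm (grad f (z n)))"
            using g \<alpha> \<mu> by (intro mult_left_mono) auto
          finally show ?thesis .
        qed
        then show False
          using sufficient_decrease [OF differentiable \<alpha>(2) \<tau>(1) angle] fail by blast
      qed
      then have "\<beta> * (d / 2) \<le> \<beta> * (\<tau> * norm (v n))"
        using \<beta> by (intro mult_left_mono) auto
      then show ?thesis
        by (simp add: norm_step \<tau>(2) c_def mult.assoc)
    qed
  qed
  moreover have "c > 0"
    using \<beta> d \<delta>\<^sub>0 A\<^sub>1 G by (simp add: c_def)
  ultimately show thesis
    using that [of "d / 2" c] d(1) by simp
qed

text \<open>Near a noncritical cluster point, infinitely many steps would have length at least a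
  fixed \<open>c\<close>, although the steps tend to 0.\<close>

lemma cluster_points_critical: "cluster_points z \<subseteq> critical_points f"
proof
  fix x assume x: "x \<in> cluster_points z"
  show "x \<in> critical_points f"
  proof (rule ccontr)
    assume "x \<notin> critical_points f"
    then obtain r c where rc: "0 < r" "0 < c"
        "\<And>n. z n \<in> ball x r \<Longrightarrow> c \<le> norm (z (Suc n) - z n)"
      using step_lower_bound_near_noncritical [of x] by (auto simp: critical_points_def)
    have "\<forall>\<^sub>F n in sequentially. norm (z (Suc n) - z n) < c"
      using steps_tendsto_0 x rc(2) order_tendstoD(2) by blast
    then have "\<forall>\<^sub>F n in sequentially. z n \<notin> ball x r"
      by (rule eventually_mono) (use rc(3) in \<open>auto simp: not_le [symmetric]\<close>)
    moreover have "\<exists>\<^sub>F n in sequentially. z n \<in> ball x r"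
      using frequently_near_cluster_point [OF x open_ball centre_in_ball [THEN iffD2]] rc(1) by blast
    ultimately show False
      by (simp add: frequently_def)
  qed
qed

section \<open>Divergence, boundedness and convergence of the iterates\<close>

lemma norm_at_top_or_steps_tendsto_0:
  "filterlim (\<lambda>n. norm (z n)) at_top sequentially \<or> (\<lambda>n. norm (z (Suc n) - z n)) \<longlonglongrightarrow> 0"
  using no_cluster_points_imp_norm_at_top steps_tendsto_0 by blast

lemma connected_cluster_points_if_bounded:
  assumes "bounded (range z)"
  shows "connected (cluster_points z)"
proof (cases "cluster_points z = {}")
  case False
  then show ?thesis
    using connected_cluster_points [OF steps_tendsto_0 assms] by blast
qed simp

text \<open>Compactness passes from components of the critical set to those of the cluster set: each
  of the latter is closed and lies in one of the former.\<close>

lemma norm_at_top_or_bounded: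
  assumes "\<forall>C \<in> components (critical_points f). compact C"
  shows "filterlim (\<lambda>n. norm (z n)) at_top sequentially \<or> bounded (range z)"
proof (cases "cluster_points z = {}")
  case False
  then obtain C where C: "C \<in> components (cluster_points z)"
    using components_eq_empty by blast
  obtain D where D: "D \<in> components (critical_points f)" "C \<subseteq> D"
    using exists_component_superset [OF _ _ in_components_connected [OF C]]
      in_components_subset [OF C] in_components_nonempty [OF C] cluster_points_critical
    by (metis subset_empty subset_trans)
  have "closed C"
    using closed_components [OF closed_cluster_points C] .
  then have "compact C"
    using D assms compact_Int_closed [of D C] by (simp add: Int_absorb1)
  then show ?thesis
    using bounded_if_cluster_component_compact [OF steps_tendsto_0 [OF False] C] by blast
qed (use no_cluster_points_imp_norm_at_top in blast)

text \<open>A connected set with two points is uncountable. Hence the components of the critical set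
  are singletons, and so is the connected cluster set of a bounded run; its only point attracts the
  sequence.\<close>

lemma norm_at_top_or_convergent:
  assumes "countable (critical_points f)"
  shows "filterlim (\<lambda>n. norm (z n)) at_top sequentially \<or> (\<exists>x \<in> critical_points f. z \<longlonglongrightarrow> x)"
proof (cases "cluster_points z = {}")
  case False
  have singleton: "a = b" if "connected C" "C \<subseteq> critical_points f" "a \<in> C" "b \<in> C" for C a b
    using connected_uncountable that countable_subset [OF _ assms] by blast
  have "compact C" if C: "C \<in> components (critical_points f)" for C
  proof -
    obtain a where "a \<in> C"
      using in_components_nonempty [OF C] by blast
    then have "C = {a}"
      using singleton in_components_connected [OF C] in_components_subset [OF C] by blast
    then show ?thesis by simp
  qed
  then consider "filterlim (\<lambda>n. norm (z n)) at_top sequentially" | "bounded (range z)"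
    using norm_at_top_or_bounded by blast
  then show ?thesis
  proof cases
    case 2
    obtain x where x: "x \<in> cluster_points z"
      using False by blast
    then have D: "cluster_points z = {x}"
      using singleton connected_cluster_points_if_bounded [OF 2] cluster_points_critical by blast
    have "(\<lambda>n. infdist (z n) {x}) \<longlonglongrightarrow> 0"
      using isolated_cluster_points_attract [OF steps_tendsto_0 [OF False], of "{x}"] D by simp
    then have "z \<longlonglongrightarrow> x"
      by (subst tendsto_dist_iff) simp
    then show ?thesis
      using x cluster_points_critical by blast
  qed simp
qed (use no_cluster_points_imp_norm_at_top in blast)

end

theorem theorem2p7:
  fixes f :: "real ^ 'm \<Rightarrow> real"
    and z :: "nat \<Rightarrow> real ^ 'm"
    and A\<^sub>1 A\<^sub>2 \<delta>\<^sub>0 \<mu> \<alpha> \<beta> :: real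
  assumes "A\<^sub>1 > 0" and "A\<^sub>2 > 0" and "\<delta>\<^sub>0 > 0"
    and "0 < \<mu>" and "\<mu> \<le> 1"
    and "0 < \<alpha>" and "\<alpha> < 1"
    and "0 < \<beta>" and "\<beta> < 1"
    and "C1_fun f"
    and "inexact_backtracking_GD A\<^sub>1 A\<^sub>2 \<delta>\<^sub>0 \<mu> \<alpha> \<beta> f z"
  shows "(filterlim (\<lambda>n. norm (z n)) at_top sequentially \<or>
          (\<lambda>n. norm (z (Suc n) - z n)) \<longlonglongrightarrow> 0)
       \<and> (countable (critical_points f) \<longrightarrow>
          filterlim (\<lambda>n. norm (z n)) at_top sequentially \<or>
          (\<exists>x \<in> critical_points f. z \<longlonglongrightarrow> x))
       \<and> ((\<forall>C \<in> components (critical_points f). compact C) \<longrightarrow>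
          (filterlim (\<lambda>n. norm (z n)) at_top sequentially \<or> bounded (range z)) \<and>
          (bounded (range z) \<longrightarrow> connected (cluster_points z)))"
proof -
  from assms(11) obtain v \<sigma> where "backtracking_GD A\<^sub>1 A\<^sub>2 \<delta>\<^sub>0 \<mu> \<alpha> \<beta> f z v \<sigma>"
    unfolding inexact_backtracking_GD_def using assms(1-10)
    by (auto simp: backtracking_GD_def)
  then interpret backtracking_GD A\<^sub>1 A\<^sub>2 \<delta>\<^sub>0 \<mu> \<alpha> \<beta> f z v \<sigma> .
  show ?thesis
    using norm_at_top_or_steps_tendsto_0 norm_at_top_or_convergent norm_at_top_or_bounded
      connected_cluster_points_if_bounded by blast
qed

end
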